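(* For every $Q=[Q_{i,j}]_{i,j=1}^3\in\{\widehat T\}'$ one has $$\operatorname{rank}(DQ_{3,1}-Q_{3,1}S)\le1,$$ where $\widehat T$, $D$ and $S$ are as described in the context.
   Context: $\mathcal L(\mathcal H)$ denotes the bounded linear operators on a complex Hilbert space $\mathcal H$ and $\{R\}'$ the commutant of $R$. Let $T=\begin{bmatrix}A&C\\ 0&B\end{bmatrix}\in\mathcal L(\mathcal H_1\oplus\mathcal H_2)$ with $\dim\mathcal H_1=\dim\mathcal H_2=\aleph_0$. Let $\mathcal H$ be a Hilbert space with orthonormal basis $\{e_k\}_{k=1}^\infty$, $(e\otimes f)h=\langle h,f\rangle e$, and $S=\sum_{k\ge1}e_{k+1}\otimes e_k$ the simple unilateral shift. Assume $A$ is similar to $S$, and let $V:\mathcal H\to\mathcal H_1$ be bounded and invertible with $VS=AV$. Let $\mu_0\in\partial\sigma(B)$, and let $\{\mu_k\}_{k\ge1}$ be distinct nonzero complex numbers in the resolvent set of $B$ converging to $\mu_0$ (fast enough) such that $B-\mu_0I$ is similar to an operator $\widehat B=\begin{bmatrix}*&*\\ F_*&D_*\end{bmatrix}\in\mathcal L(\mathcal H\oplus\mathcal H)$, where $D_*=\sum_{k\ge1}(\mu_k-\mu_0)e_k\otimes e_k$ and $\operatorname{rank}F_*=1$; let $W:\mathcal H\oplus\mathcal H\to\mathcal H_2$ be bounded and invertible with $W\widehat B=(B-\mu_0I)W$. With $Z=V\oplus W$ put $\widehat T=Z^{-1}(T-\mu_0I)Z=\begin{bmatrix}S-\mu_0I&V^{-1}CW\\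 0&\widehat B\end{bmatrix}\in\mathcal L(\mathcal H\oplus\mathcal H\oplus\mathcal H)$; operators on $\mathcal H\oplus\mathcal H\oplus\mathcal H$ are written as $3\times3$ operator matrices. Finally $D=D_*+\mu_0I=\sum_{k\ge1}\mu_ke_k\otimes e_k$. *)

theory Defs
  imports "HOL-Analysis.Analysis" "HOL-Library.Extended_Nat"
begin

text \<open>
  HOL-Analysis provides only real inner product spaces. A complex Hilbert space is a complete real
  inner product space with a compatible complex scalar multiplication and a complex inner product
  whose real part is the real one. The norm is thus \<open>sqrt (Re (cinner x x))\<close>, and
  \<open>cinner x x\<close> is real by \<open>cinner_commute\<close>. The inner product is linear in its first argument.
\<close>

class complex_vector = real_vector +
  fixes scaleC :: "complex \<Rightarrow> 'a \<Rightarrow> 'a" (infixr "*\<^sub>C" 75)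
  assumes scaleC_add_right: "a *\<^sub>C (x + y) = a *\<^sub>C x + a *\<^sub>C y"
    and scaleC_add_left: "(a + b) *\<^sub>C x = a *\<^sub>C x + b *\<^sub>C x"
    and scaleC_scaleC: "a *\<^sub>C b *\<^sub>C x = (a * b) *\<^sub>C x"
    and scaleC_of_real: "complex_of_real r *\<^sub>C x = r *\<^sub>R x"

class complex_inner = complex_vector + real_inner +
  fixes cinner :: "'a \<Rightarrow> 'a \<Rightarrow> complex"
  assumes cinner_commute: "cinner x y = cnj (cinner y x)"
    and cinner_add_left: "cinner (x + y) z = cinner x z + cinner y z"
    and cinner_scaleC_left: "cinner (a *\<^sub>C x) y = a * cinner x y"
    and Re_cinner: "Re (cinner x y) = inner x y"

class complex_hilbert = complex_inner + complete_space

instantiation prod :: (complex_vector, complex_vector) complex_vector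
begin

definition "a *\<^sub>C p = (a *\<^sub>C fst p, a *\<^sub>C snd p)"

instance
  by standard (simp_all add: scaleC_prod_def scaleC_add_right scaleC_add_left scaleC_scaleC
      scaleC_of_real prod_eq_iff)

end

text \<open>The product type with this inner product is the Hilbert space direct sum.\<close>

instantiation prod :: (complex_inner, complex_inner) complex_inner
begin

definition "cinner p q = cinner (fst p) (fst q) + cinner (snd p) (snd q)"

instance
proof
  fix x y z :: "'a \<times> 'b" and a :: complex
  show "cinner x y = cnj (cinner y x)"
    unfolding cinner_prod_def complex_cnj_add by (metis cinner_commute)
  show "cinner (x + y) z = cinner x z + cinner y z"
    by (simp add: cinner_prod_def cinner_add_left)
  show "cinner (a *\<^sub>C x) y = a * cinner x y"
    by (simp add: cinner_prod_def scaleC_prod_def cinner_scaleC_left algebra_simps)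
  show "Re (cinner x y) = inner x y"
    by (simp add: cinner_prod_def inner_prod_def Re_cinner)
qed

end

instance prod :: (complex_hilbert, complex_hilbert) complex_hilbert ..

lemma scaleC_one [simp]: "1 *\<^sub>C x = (x :: 'a::complex_vector)"
  using scaleC_of_real[of 1 x] by simp

global_interpretation complex_vector:
  vector_space "scaleC :: complex \<Rightarrow> 'a \<Rightarrow> 'a::complex_vector"
  by unfold_locales (simp_all add: scaleC_add_right scaleC_add_left scaleC_scaleC)

definition orthonormal_basis :: "(nat \<Rightarrow> 'a::complex_inner) \<Rightarrow> bool" where
  "orthonormal_basis e \<longleftrightarrow>
     (\<forall>i j. cinner (e i) (e j) = (if i = j then 1 else 0)) \<and>
     closure (complex_vector.span (range e)) = UNIV"

definition bounded_clinear :: "('a::complex_inner \<Rightarrow> 'b::complex_inner) \<Rightarrow> bool" where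
  "bounded_clinear f \<longleftrightarrow> bounded_linear f \<and> (\<forall>c x. f (c *\<^sub>C x) = c *\<^sub>C f x)"

definition invertible_op :: "('a::complex_inner \<Rightarrow> 'b::complex_inner) \<Rightarrow> bool" where
  "invertible_op f \<longleftrightarrow> bounded_clinear f \<and> bij f \<and> bounded_clinear (inv f)"

definition spectrum_op :: "('a::complex_inner \<Rightarrow> 'a) \<Rightarrow> complex set" where
  "spectrum_op f = {z. \<not> invertible_op (\<lambda>x. f x - z *\<^sub>C x)}"

abbreviation resolvent_set :: "('a::complex_inner \<Rightarrow> 'a) \<Rightarrow> complex set" where
  "resolvent_set f \<equiv> - spectrum_op f"

definition commutant :: "('a::complex_inner \<Rightarrow> 'a) \<Rightarrow> ('a \<Rightarrow> 'a) set" where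
  "commutant R = {Q. bounded_clinear Q \<and> Q \<circ> R = R \<circ> Q}"

text \<open>
  The library's \<open>dim\<close> is a \<open>nat\<close> and carries no information for infinite-dimensional spaces, so
  these are separated out explicitly.
\<close>

definition op_rank :: "('a::complex_inner \<Rightarrow> 'b::complex_inner) \<Rightarrow> enat" where
  "op_rank f =
     (if \<exists>E. finite E \<and> range f \<subseteq> complex_vector.span E
      then enat (complex_vector.dim (range f)) else \<infinity>)"

definition rank_one :: "'b::complex_inner \<Rightarrow> 'a::complex_inner \<Rightarrow> 'a \<Rightarrow> 'b" where
  "rank_one e f h = cinner h f *\<^sub>C e"

text \<open>The sums below converge in the strong operator topology, that is, pointwise.\<close>

definition shift_op :: "(nat \<Rightarrow> 'a::complex_inner) \<Rightarrow> 'a \<Rightarrow> 'a" where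
  "shift_op e h = (\<Sum>k. rank_one (e (Suc k)) (e k) h)"

definition diag_op :: "(nat \<Rightarrow> 'a::complex_inner) \<Rightarrow> (nat \<Rightarrow> complex) \<Rightarrow> 'a \<Rightarrow> 'a" where
  "diag_op e d h = (\<Sum>k. d k *\<^sub>C rank_one (e k) (e k) h)"

definition op_matrix2 ::
  "('a \<Rightarrow> 'c) \<Rightarrow> ('b \<Rightarrow> 'c) \<Rightarrow> ('a \<Rightarrow> 'd) \<Rightarrow> ('b \<Rightarrow> 'd) \<Rightarrow> 'a \<times> 'b \<Rightarrow> 'c::plus \<times> 'd::plus"
  where "op_matrix2 A11 A12 A21 A22 = (\<lambda>(x, y). (A11 x + A12 y, A21 x + A22 y))"

text \<open>Coordinates are numbered 1, 2, 3; other values of \<open>i\<close> are not used.\<close>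

definition emb3 :: "nat \<Rightarrow> 'a::zero \<Rightarrow> 'a \<times> 'a \<times> 'a" where
  "emb3 i h = (if i = 1 then h else 0, if i = 2 then h else 0, if i = 3 then h else 0)"

definition proj3 :: "nat \<Rightarrow> 'a \<times> 'a \<times> 'a \<Rightarrow> 'a" where
  "proj3 i = (\<lambda>(x, y, z). if i = 1 then x else if i = 2 then y else z)"

definition entry3 ::
  "('a::zero \<times> 'a \<times> 'a \<Rightarrow> 'a \<times> 'a \<times> 'a) \<Rightarrow> nat \<Rightarrow> nat \<Rightarrow> 'a \<Rightarrow> 'a" where
  "entry3 Q i j h = proj3 i (Q (emb3 j h))"

end

theory Submission
  imports Defs
begin

text \<open>
  The \<open>(3,1)\<close> entry of \<open>Q That = That Q\<close> reads
  \<open>Q31 (S - \<mu>0 I) = F Q21 + Dstar Q31\<close>, because the first column of \<open>That\<close> is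
  \<open>(S - \<mu>0 I, 0, 0)\<close> and its last row is \<open>(0, F, Dstar)\<close>. Hence
  \<open>D Q31 - Q31 S = - F Q21\<close>, whose range lies in that of \<open>F\<close>. The identity
  \<open>D = Dstar + \<mu>0 I\<close> for the pointwise series needs their convergence (Bessel) and the expansion
  of a vector in an orthonormal basis.
\<close>

section \<open>Complex scalars, the norm, and rank at most one\<close>

lemma cinner_scaleC_right: "cinner x (a *\<^sub>C y) = cnj a * cinner x y"
  by (metis cinner_commute cinner_scaleC_left complex_cnj_mult)

lemma cinner_self: "cinner x x = complex_of_real ((norm x)\<^sup>2)"
proof (rule complex_eqI)
  show "Re (cinner x x) = Re (complex_of_real ((norm x)\<^sup>2))"
    by (simp add: Re_cinner power2_norm_eq_inner)
  show "Im (cinner x x) = Im (complex_of_real ((norm x)\<^sup>2))"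
    using arg_cong[OF cinner_commute[of x x], of Im] by simp
qed

text \<open>The class axioms relate the norm to real scalars only; complex homogeneity follows
  because \<open>cinner x x\<close> is the squared norm.\<close>

lemma norm_scaleC: "norm (a *\<^sub>C x) = cmod a * norm (x :: 'a::complex_inner)"
proof -
  have "complex_of_real ((norm (a *\<^sub>C x))\<^sup>2) = a * cnj a * complex_of_real ((norm x)\<^sup>2)"
    unfolding cinner_self[symmetric] cinner_scaleC_left cinner_scaleC_right
    by (simp add: mult_ac)
  also have "\<dots> = complex_of_real ((cmod a * norm x)\<^sup>2)"
    by (simp add: complex_norm_square[symmetric] power_mult_distrib)
  finally have "(norm (a *\<^sub>C x))\<^sup>2 = (cmod a * norm x)\<^sup>2"
    by (simp only: of_real_eq_iff)
  then show ?thesis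
    by (simp add: power2_eq_iff_nonneg)
qed

lemma bounded_linear_scaleC: "bounded_linear (\<lambda>x :: 'a::complex_inner. a *\<^sub>C x)"
proof (rule bounded_linear_intro[where K = "cmod a"])
  show "a *\<^sub>C (r *\<^sub>R x) = r *\<^sub>R a *\<^sub>C x" for r and x :: 'a
    by (simp add: scaleC_of_real[symmetric] scaleC_scaleC mult.commute)
qed (simp_all add: scaleC_add_right norm_scaleC mult.commute)

lemma op_rank_le_oneI:
  assumes "op_rank F = 1" and "range G \<subseteq> range F"
  shows "op_rank G \<le> 1"
proof -
  have dim: "complex_vector.dim (range F) = 1"
    using assms(1) by (auto simp: op_rank_def one_enat_def split: if_splits)
  \<comment> \<open>A basis of \<open>range F\<close> is a single vector, and it also spans
    \<open>range G\<close>. Having cardinality 1 makes \<open>E\<close> finite, since infinite sets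
    have \<open>card\<close> 0; this excludes the infinite value of
    \<open>op_rank G\<close>.\<close>
  obtain E where E: "range F \<subseteq> complex_vector.span E" "card E = 1"
    using complex_vector.basis_exists[of "range F"] dim by metis
  then have fin: "finite E"
    by (simp add: card_ge_0_finite)
  have sub: "range G \<subseteq> complex_vector.span E"
    using assms(2) E(1) by blast
  then have "complex_vector.dim (range G) \<le> 1"
    using complex_vector.dim_le_card[OF sub fin] E(2) by simp
  then show ?thesis
    using fin sub by (auto simp: op_rank_def one_enat_def)
qed

section \<open>Orthonormal systems and expansions\<close>

context
  fixes e :: "nat \<Rightarrow> 'a::complex_inner"
  assumes ortho: "\<And>i j. cinner (e i) (e j) = (if i = j then 1 else 0)"
begin

lemma norm_orthonormal: "norm (e k) = 1"
  using cinner_self[of "e k"] by (simp add: ortho abs_square_eq_1 flip: of_real_power)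

lemma norm_sum_orthonormal:
  assumes "finite I"
  shows "(norm (\<Sum>k\<in>I. a k *\<^sub>C e k))\<^sup>2 = (\<Sum>k\<in>I. (cmod (a k))\<^sup>2)"
proof -
  have "(norm (\<Sum>k\<in>I. a k *\<^sub>C e k))\<^sup>2 = (\<Sum>k\<in>I. (norm (a k *\<^sub>C e k))\<^sup>2)"
    using assms
    by (intro norm_sum_Pythagorean)
      (auto simp: pairwise_def orthogonal_def Re_cinner[symmetric] cinner_scaleC_left
        cinner_scaleC_right ortho)
  then show ?thesis
    by (simp add: norm_scaleC norm_orthonormal)
qed

text \<open>The projection \<open>p\<close> of \<open>h\<close> onto finitely many basis vectors has
  both \<open>inner h p\<close> and its squared norm equal to the sum, so the claim is nonnegativity
  of the squared norm of \<open>h - p\<close>.\<close>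

lemma bessel:
  assumes "finite I"
  shows "(\<Sum>k\<in>I. (cmod (cinner h (e k)))\<^sup>2) \<le> (norm h)\<^sup>2"
proof -
  define p where "p = (\<Sum>k\<in>I. cinner h (e k) *\<^sub>C e k)"
  have "inner h p = (\<Sum>k\<in>I. (cmod (cinner h (e k)))\<^sup>2)"
    unfolding p_def inner_sum_right
    by (simp add: Re_cinner[symmetric] cinner_scaleC_right cmod_power2)
      (simp add: power2_eq_square)
  moreover have "(norm p)\<^sup>2 = (\<Sum>k\<in>I. (cmod (cinner h (e k)))\<^sup>2)"
    unfolding p_def by (rule norm_sum_orthonormal[OF assms])
  moreover have "0 \<le> (norm (h - p))\<^sup>2"
    by simp
  ultimately show ?thesis
    by (simp add: power2_norm_eq_inner inner_diff inner_commute)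
qed

end

text \<open>By Pythagoras, blocks of the series are controlled by blocks of \<open>b\<close>, which
  the Bessel series dominates; completeness does the rest. Bounded weights cover both the expansion
  of \<open>h\<close> (weights 1) and diagonal operators.\<close>

lemma summable_orthonormal:
  fixes e :: "nat \<Rightarrow> 'a::complex_hilbert"
  assumes ortho: "\<And>i j. cinner (e i) (e j) = (if i = j then 1 else 0)"
    and "Bseq d"
  shows "summable (\<lambda>k. (d k * cinner h (e k)) *\<^sub>C e k)"
proof -
  obtain M where M: "\<And>k. cmod (d k) \<le> M"
    using assms(2) by (auto simp: Bseq_def)
  define b where "b k = (cmod (d k * cinner h (e k)))\<^sup>2" for k
  have "summable (\<lambda>k. (cmod (cinner h (e k)))\<^sup>2)"
    by (rule summableI_nonneg_bounded) (auto intro: bessel[OF ortho])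
  then have "summable (\<lambda>k. M\<^sup>2 * (cmod (cinner h (e k)))\<^sup>2)"
    by (rule summable_mult)
  then have b: "summable b"
    by (rule summable_comparison_test')
      (auto simp: b_def norm_mult power_mult_distrib intro!: mult_right_mono power_mono M)
  have "Cauchy (\<lambda>n. \<Sum>k<n. (d k * cinner h (e k)) *\<^sub>C e k)"
  proof (rule metric_CauchyI)
    fix r :: real
    assume "0 < r"
    \<comment> \<open>The threshold is the square of \<open>r\<close> because \<open>b\<close>
      measures squared norms.\<close>
    then obtain N where N: "\<And>m n. m \<ge> N \<Longrightarrow> norm (sum b {m..<n}) < r\<^sup>2"
      using b unfolding summable_Cauchy by (meson zero_less_power)
    have less: "dist (\<Sum>k<n. (d k * cinner h (e k)) *\<^sub>C e k)
        (\<Sum>k<m. (d k * cinner h (e k)) *\<^sub>C e k) < r" if "N \<le> m" "m \<le> n" for m n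
    proof -
      have "(\<Sum>k<n. (d k * cinner h (e k)) *\<^sub>C e k) - (\<Sum>k<m. (d k * cinner h (e k)) *\<^sub>C e k)
          = (\<Sum>k\<in>{m..<n}. (d k * cinner h (e k)) *\<^sub>C e k)"
        using sum_diff_nat_ivl[of 0 m n "\<lambda>k. (d k * cinner h (e k)) *\<^sub>C e k"] that
        by (simp add: atLeast0LessThan)
      moreover have "(norm (\<Sum>k\<in>{m..<n}. (d k * cinner h (e k)) *\<^sub>C e k))\<^sup>2 < r\<^sup>2"
        using N[OF that(1), of n] norm_sum_orthonormal[OF ortho, of "{m..<n}"]
        by (simp add: b_def)
      ultimately show ?thesis
        using \<open>0 < r\<close> by (simp add: dist_norm power_less_imp_less_base)
    qed
    show "\<exists>K. \<forall>m\<ge>K. \<forall>n\<ge>K. dist (\<Sum>k<m. (d k * cinner h (e k)) *\<^sub>C e k)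
        (\<Sum>k<n. (d k * cinner h (e k)) *\<^sub>C e k) < r"
    proof (intro exI[of _ N] allI impI)
      fix m n
      assume "N \<le> m" "N \<le> n"
      then show "dist (\<Sum>k<m. (d k * cinner h (e k)) *\<^sub>C e k)
          (\<Sum>k<n. (d k * cinner h (e k)) *\<^sub>C e k) < r"
        using less[of m n] less[of n m] by (cases "m \<le> n") (simp_all add: dist_commute)
    qed
  qed
  then show ?thesis
    by (simp add: summable_iff_convergent Cauchy_convergent)
qed

text \<open>The series has some limit \<open>g\<close>; \<open>h - g\<close> is orthogonal to every
  \<open>e j\<close>, hence to the dense span, hence to itself.\<close>

lemma orthonormal_basis_sums:
  fixes e :: "nat \<Rightarrow> 'a::complex_hilbert"
  assumes "orthonormal_basis e"
  shows "(\<lambda>k. cinner h (e k) *\<^sub>C e k) sums h"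
proof -
  have ortho: "\<And>i j. cinner (e i) (e j) = (if i = j then 1 else 0)"
    and dense: "closure (complex_vector.span (range e)) = UNIV"
    using assms by (auto simp: orthonormal_basis_def)
  obtain g where g: "(\<lambda>k. cinner h (e k) *\<^sub>C e k) sums g"
    using summable_orthonormal[OF ortho, of "\<lambda>_. 1" h] by (auto simp: summable_def)
  \<comment> \<open>\<open>inner\<close> is only the real part of \<open>cinner\<close>, so all
    complex multiples of \<open>e j\<close> are tested.\<close>
  have basis: "inner (h - g) (a *\<^sub>C e j) = 0" for a j
  proof -
    have "(\<lambda>k. inner (cinner h (e k) *\<^sub>C e k) (a *\<^sub>C e j)) sums inner g (a *\<^sub>C e j)"
      using bounded_linear.sums[OF bounded_linear_inner_left g] .
    moreover have "inner (cinner h (e k) *\<^sub>C e k) (a *\<^sub>C e j)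
        = (if k = j then inner h (a *\<^sub>C e k) else 0)" for k
      by (simp add: Re_cinner[symmetric] cinner_scaleC_left cinner_scaleC_right ortho algebra_simps)
    ultimately have "(\<lambda>k. if k = j then inner h (a *\<^sub>C e k) else 0) sums inner g (a *\<^sub>C e j)"
      by simp
    then have "inner g (a *\<^sub>C e j) = inner h (a *\<^sub>C e j)"
      using sums_single[of j "\<lambda>k. inner h (a *\<^sub>C e k)"] sums_unique2 by blast
    then show ?thesis
      by (simp add: inner_diff_left)
  qed
  \<comment> \<open>Keeping \<open>a\<close> quantified makes the admissible \<open>v\<close> a
    complex subspace, as the span induction requires.\<close>
  have "\<forall>a. inner (h - g) (a *\<^sub>C v) = 0" if "v \<in> complex_vector.span (range e)" for v
    using that
  proof (induction rule: complex_vector.span_induct)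
    case base
    show ?case
      by (auto simp: complex_vector.subspace_def scaleC_add_right inner_add_right scaleC_scaleC)
  next
    case (step x)
    then show ?case
      using basis by auto
  qed
  then have "complex_vector.span (range e) \<subseteq> {v. inner (h - g) v = 0}"
    by (metis (mono_tags) mem_Collect_eq scaleC_one subsetI)
  then have "closure (complex_vector.span (range e)) \<subseteq> {v. inner (h - g) v = 0}"
    by (rule closure_minimal) (rule closed_hyperplane)
  then have "inner (h - g) (h - g) = 0"
    unfolding dense by blast
  then show ?thesis
    using g by simp
qed

text \<open>Termwise subtraction is legitimate once both series converge; the subtracted one is
  \<open>c\<close> times the expansion of \<open>h\<close>.\<close>

lemma diag_op_diff_const:
  fixes e :: "nat \<Rightarrow> 'a::complex_hilbert"
  assumes "orthonormal_basis e" and "Bseq d"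
  shows "diag_op e (\<lambda>k. d k - c) h = diag_op e d h - c *\<^sub>C h"
proof -
  have "(\<lambda>k. (d k * cinner h (e k)) *\<^sub>C e k) sums diag_op e d h"
    using summable_orthonormal[of e d h] assms
    by (simp add: orthonormal_basis_def diag_op_def rank_one_def scaleC_scaleC summable_sums)
  moreover have "(\<lambda>k. c *\<^sub>C cinner h (e k) *\<^sub>C e k) sums (c *\<^sub>C h)"
    using bounded_linear.sums[OF bounded_linear_scaleC orthonormal_basis_sums[OF assms(1)]] .
  ultimately have "(\<lambda>k. (d k * cinner h (e k)) *\<^sub>C e k - c *\<^sub>C cinner h (e k) *\<^sub>C e k)
      sums (diag_op e d h - c *\<^sub>C h)"
    by (rule sums_diff)
  then show ?thesis
    by (simp add: diag_op_def rank_one_def scaleC_scaleC sums_iff left_diff_distrib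
        complex_vector.scale_left_diff_distrib)
qed

section \<open>Entries of \<open>That\<close> and the commutation relation\<close>

theorem proposition7:
  fixes e :: "nat \<Rightarrow> 'h::complex_hilbert"
    and A :: "'h1::complex_hilbert \<Rightarrow> 'h1"
    and B :: "'h2::complex_hilbert \<Rightarrow> 'h2"
    and C :: "'h2 \<Rightarrow> 'h1"
    and V :: "'h \<Rightarrow> 'h1"
    and W :: "'h \<times> 'h \<Rightarrow> 'h2"
    and X Y F S Dstar D :: "'h \<Rightarrow> 'h"
    and Bhat :: "'h \<times> 'h \<Rightarrow> 'h \<times> 'h"
    and T :: "'h1 \<times> 'h2 \<Rightarrow> 'h1 \<times> 'h2"
    and Z :: "'h \<times> 'h \<times> 'h \<Rightarrow> 'h1 \<times> 'h2"
    and That Q :: "'h \<times> 'h \<times> 'h \<Rightarrow> 'h \<times> 'h \<times> 'h"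
    and \<mu> :: "nat \<Rightarrow> complex" and \<mu>\<^sub>0 :: complex
  assumes "\<exists>f :: nat \<Rightarrow> 'h1. orthonormal_basis f"
    and "\<exists>f :: nat \<Rightarrow> 'h2. orthonormal_basis f"
    and "orthonormal_basis e"
    and "S = shift_op e"
    and "bounded_clinear A" and "bounded_clinear B" and "bounded_clinear C"
    and "T = op_matrix2 A C (\<lambda>_. 0) B"
    and "invertible_op V" and "V \<circ> S = A \<circ> V"
    and "\<mu>\<^sub>0 \<in> frontier (spectrum_op B)"
    and "inj \<mu>" and "\<And>k. \<mu> k \<noteq> 0" and "\<And>k. \<mu> k \<in> resolvent_set B"
    and "\<mu> \<longlonglongrightarrow> \<mu>\<^sub>0"
    and "Dstar = diag_op e (\<lambda>k. \<mu> k - \<mu>\<^sub>0)"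
    and "bounded_clinear X" and "bounded_clinear Y" and "bounded_clinear F"
    and "op_rank F = 1"
    and "Bhat = op_matrix2 X Y F Dstar"
    and "invertible_op W" and "W \<circ> Bhat = (\<lambda>x. B x - \<mu>\<^sub>0 *\<^sub>C x) \<circ> W"
    and "Z = map_prod V W"
    and "That = inv Z \<circ> (\<lambda>x. T x - \<mu>\<^sub>0 *\<^sub>C x) \<circ> Z"
    and "D = diag_op e \<mu>"
    and "Q \<in> commutant That"
  shows "op_rank (\<lambda>h. D (entry3 Q 3 1 h) - entry3 Q 3 1 (S h)) \<le> 1"
proof -
  have bij: "bij V" "bij W" and lin: "linear V" "linear W" "linear C" "linear Q" "linear F"
    and V_scale: "V (a *\<^sub>C x) = a *\<^sub>C V x" for a x
    using assms(7,9,19,22,27)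
    by (auto simp: invertible_op_def bounded_clinear_def commutant_def bounded_linear.linear)
  have inv_Z: "inv Z (V x, W y) = (x, y)" for x y
    using bij by (intro inv_f_eq) (auto simp: assms(24) bij_def intro: prod.inj_map)
  have VS: "A (V x) = V (S x)" for x
    using assms(10) by (metis comp_apply)
  have WB: "B (W p) - \<mu>\<^sub>0 *\<^sub>C W p = W (Bhat p)" for p
    using assms(23) by (metis comp_apply)
  have That: "That (x, p) = inv Z (A (V x) + C (W p) - \<mu>\<^sub>0 *\<^sub>C V x, W (Bhat p))" for x p
    by (simp add: assms(8,24,25) op_matrix2_def scaleC_prod_def WB[symmetric])
  \<comment> \<open>\<open>inv_Z\<close> applies only to pairs of the form
    \<open>(V x, W y)\<close>, so the first component is written as \<open>V x'\<close>; the third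
    coordinate does not see \<open>x'\<close>.\<close>
  have last_row: "proj3 3 (That (x, y, z)) = F y + Dstar z" for x y z
  proof -
    obtain x' where "A (V x) + C (W (y, z)) - \<mu>\<^sub>0 *\<^sub>C V x = V x'"
      using bij(1) by (metis bij_pointE)
    then show ?thesis
      by (simp add: That inv_Z) (simp add: assms(21) op_matrix2_def proj3_def)
  qed
  have first_column: "That (emb3 1 x) = emb3 1 (S x - \<mu>\<^sub>0 *\<^sub>C x)" for x
  proof -
    have W0: "W (0, 0) = 0"
      using linear_0[OF lin(2)] by (simp add: zero_prod_def)
    \<comment> \<open>That \<open>Bhat\<close> vanishes at 0 is inherited from \<open>B\<close>
      through the intertwining with \<open>W\<close>, so linearity of the series
      \<open>Dstar\<close> need not be shown.\<close>
    have "W (Bhat (0, 0)) = W (0, 0)"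
      by (simp add: WB[symmetric] W0 linear_0 assms(6)[unfolded bounded_clinear_def]
          bounded_linear.linear)
    moreover have "A (V x) + C (W (0, 0)) - \<mu>\<^sub>0 *\<^sub>C V x = V (S x - \<mu>\<^sub>0 *\<^sub>C x)"
      by (simp add: W0 linear_0 lin VS linear_diff V_scale)
    ultimately show ?thesis
      by (simp add: emb3_def That inv_Z)
  qed
  \<comment> \<open>The sign is put inside \<open>F\<close> so that the value visibly lies in
    \<open>range F\<close>.\<close>
  have "D (entry3 Q 3 1 h) - entry3 Q 3 1 (S h) = F (- entry3 Q 2 1 h)" for h
  proof -
    obtain q1 q2 q3 where q: "Q (emb3 1 h) = (q1, q2, q3)"
      by (metis surj_pair)
    have Q_scale: "Q (a *\<^sub>C x) = a *\<^sub>C Q x" for a x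
      using assms(27)
      by (simp add: commutant_def bounded_clinear_def del: split_paired_All)
    have "emb3 1 (S h - \<mu>\<^sub>0 *\<^sub>C h) = emb3 1 (S h) - \<mu>\<^sub>0 *\<^sub>C (emb3 1 h :: 'h \<times> 'h \<times> 'h)"
      by (simp add: emb3_def scaleC_prod_def zero_prod_def)
    then have "Q (That (emb3 1 h)) = Q (emb3 1 (S h)) - \<mu>\<^sub>0 *\<^sub>C Q (emb3 1 h)"
      by (simp only: first_column linear_diff[OF lin(4)] Q_scale)
    moreover have "Q (That (emb3 1 h)) = That (Q (emb3 1 h))"
      using assms(27) unfolding commutant_def by (metis (mono_tags) comp_apply mem_Collect_eq)
    \<comment> \<open>Third coordinates of the two sides of the commutation relation at
      \<open>emb3 1 h\<close>; \<open>q1\<close> drops out since the last row of \<open>That\<close>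
      starts with 0.\<close>
    ultimately have "proj3 3 (Q (emb3 1 (S h)) - \<mu>\<^sub>0 *\<^sub>C Q (emb3 1 h)) = F q2 + Dstar q3"
      using last_row by (metis q)
    then have "entry3 Q 3 1 (S h) - \<mu>\<^sub>0 *\<^sub>C q3 = F q2 + Dstar q3"
      unfolding q entry3_def
      by (cases "Q (emb3 1 (S h))" rule: prod_cases3) (simp add: proj3_def scaleC_prod_def)
    \<comment> \<open>The weights \<open>\<mu>\<close> are bounded because they converge.\<close>
    moreover have "Dstar q3 = D q3 - \<mu>\<^sub>0 *\<^sub>C q3"
      unfolding assms(16,26)
      by (rule diag_op_diff_const[OF assms(3)])
        (use assms(15) in \<open>auto intro: convergent_imp_Bseq convergentI\<close>)
    moreover have "entry3 Q 3 1 h = q3" "entry3 Q 2 1 h = q2"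
      unfolding q entry3_def by (simp_all add: proj3_def)
    ultimately show ?thesis
      by (simp add: linear_neg[OF lin(5)] algebra_simps)
  qed
  then show ?thesis
    by (intro op_rank_le_oneI[OF assms(20)]) auto
qed

end
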